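(* For any $\delta,\varepsilon>0$ and any integer $m\ge 2$ there is a constant $C>0$ (depending only on $\delta,\varepsilon,m$) such that the following holds for every integer $n\ge 1$. If the retention probabilities $(p_\zeta)_{\zeta\in[m]}\in(0,1]^m$ satisfy $\min_{\zeta\in[m]}p_\zeta\ge\delta$, then the string $\mathbf{x}\in[m]^n$ can be reconstructed with probability at least $1-\varepsilon$ from $T=\lceil\exp(Cn^{1/3})\rceil$ i.i.d. samples of the letter-dependent deletion channel applied to $\mathbf{x}$. This holds also in the case when the deletion probabilities are unknown; that is, there is a function $F:\big(\bigcup_{j=0}^n[m]^j\big)^T\to[m]^n$, not depending on $\mathbf{x}$ or on $(p_\zeta)_{\zeta\in[m]}$, such that for every $\mathbf{x}\in[m]^n$ and every $(p_\zeta)_{\zeta\in[m]}\in(0,1]^m$ with $\min_{\zeta\in[m]}p_\zeta\ge\delta$, $$\mathbb{P}\big[F(\widetilde{\mathbf{X}}^{(1)},\dots,\widetilde{\mathbf{X}}^{(T)})=\mathbf{x}\big]\ge 1-\varepsilon,$$ where $\widetilde{\mathbf{X}}^{(1)},\dots,\widetilde{\mathbf{X}}^{(T)}$ are independent outputs of the letter-dependent deletion channel with retention probabilities $(p_\zeta)_{\zeta\in[m]}$ applied to $\mathbf{x}$.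
   Context: Notation: $[m]=\{0,1,\dots,m-1\}$. Strings of length $n$ are indexed as $\mathbf{x}=(x_0,\dots,x_{n-1})$. Letter-dependent deletion channel with retention probabilities $p_\zeta\in(0,1]$, $\zeta\in[m]$, and deletion probabilities $q_\zeta=1-p_\zeta$: given an input string $\mathbf{x}=(x_0,\dots,x_{n-1})\in[m]^n$, independently for each $k=0,\dots,n-1$ the entry $x_k$ is retained with probability $p_{x_k}$ and deleted with probability $q_{x_k}$. The output $\widetilde{\mathbf{X}}$ (a "trace" or "sample") is the string obtained by concatenating the retained entries in their original order; it is a random element of $\bigcup_{j=0}^n[m]^j$. "Can be reconstructed with probability at least $1-\varepsilon$ from $T$ i.i.d. samples" means that there is a function of the $T$ samples, not depending on $\mathbf{x}$, which equals $\mathbf{x}$ with probability at least $1-\varepsilon$ for every $\mathbf{x}\in[m]^n$. In the case of known deletion probabilities the function may depend on $(p_\zeta)$; in the case of unknown deletion probabilities it may not. *)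

theory Defs
  imports "HOL-Probability.Probability"
begin

text \<open>The set \<open>[m]^n\<close>, where \<open>[m] = {0, \<dots>, m - 1}\<close>; \<open>x ! k\<close> is the entry \<open>x\<^sub>k\<close>.\<close>

definition strings :: "nat \<Rightarrow> nat \<Rightarrow> nat list set" where
  "strings m n = {x. length x = n \<and> set x \<subseteq> {..<m}}"

definition traces :: "nat \<Rightarrow> nat \<Rightarrow> nat list set" where
  "traces m n = (\<Union>j\<in>{0..n}. strings m j)"

text \<open>The coin \<open>b k\<close> says whether the entry \<open>x ! k\<close> is retained, and \<open>nths x S\<close> keeps the
  entries of \<open>x\<close> with index in \<open>S\<close>, in order. The value \<open>False\<close> is the default that
  \<open>Pi_pmf\<close> assigns outside of its index set.\<close>

definition deletion_channel :: "(nat \<Rightarrow> real) \<Rightarrow> nat list \<Rightarrow> nat list pmf" where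
  "deletion_channel p x =
     map_pmf (\<lambda>b. nths x {k. b k})
       (Pi_pmf {..<length x} False (\<lambda>k. bernoulli_pmf (p (x ! k))))"

text \<open>Only the values of \<open>p\<close> on \<open>[m]\<close> are constrained (and used).\<close>

definition retention_probs :: "nat \<Rightarrow> (nat \<Rightarrow> real) \<Rightarrow> bool" where
  "retention_probs m p \<longleftrightarrow> (\<forall>\<zeta><m. 0 < p \<zeta> \<and> p \<zeta> \<le> 1)"

text \<open>A \<open>T\<close>-tuple of traces is a list of length \<open>T\<close>; \<open>replicate_pmf T M\<close> is the law of
  \<open>T\<close> independent draws from \<open>M\<close>.\<close>

definition reconstructs ::
  "nat \<Rightarrow> nat \<Rightarrow> nat \<Rightarrow> real \<Rightarrow> (nat \<Rightarrow> real) \<Rightarrow> (nat list list \<Rightarrow> nat list) \<Rightarrow> bool" where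
  "reconstructs m n T \<epsilon> p F \<longleftrightarrow>
     F \<in> {Y. length Y = T \<and> set Y \<subseteq> traces m n} \<rightarrow> strings m n \<and>
     (\<forall>x\<in>strings m n.
        measure_pmf.prob (replicate_pmf T (deletion_channel p x)) {Y. F Y = x} \<ge> 1 - \<epsilon>)"

end

theory Submission
  imports Defs "HOL-Complex_Analysis.Complex_Analysis"
begin

text \<open>
  A candidate is a pair \<open>(x, p)\<close> of an input string and a vector of retention probabilities.
  Finitely many \<open>[0, 1]\<close>-valued statistics of a trace, \<open>O(m\<^sup>3 n)\<close> in number, are averaged over the
  samples, and the decoder returns the string of a candidate whose expected statistics match these
  averages. By Chebyshev's inequality and a union bound the true candidate matches with
  probability at least \<open>1 - \<epsilon>\<close>. So the theorem reduces to a separation statement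
  (\<open>test_statistics_identify\<close>): candidates with different strings have some statistic whose
  expectations differ by at least \<open>exp (- C n\<^bsup>1/3\<^esup>)\<close>, whatever the two probability vectors are.

  Suppose first that the probabilities agree (\<open>two_letter_separation\<close>). Deleting all letters except
  \<open>a\<close> and \<open>c\<close> commutes with the channel, and a string is determined by its restrictions to pairs
  of letters, so one may assume that the strings \<open>u \<noteq> v\<close> use only \<open>a\<close> and \<open>c\<close>, where \<open>p a \<le> p c\<close>.
  The statistics are the indicators of the event that the \<open>k\<close>-th letter of the trace is \<open>l\<close>.
  Their generating function in a variable \<open>w\<close> has expectation
  \<open>p l * (\<Sum>k | u ! k = l. \<Prod>j<k. \<phi>(u ! j))\<close>, where \<open>\<phi>(t) = 1 - p t * (1 - w)\<close>. The variable
  \<open>z = \<phi>(c)\<close> of the letter that is retained more often makes every factor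
  \<open>\<phi>(t) = 1 - (p t / p c) (1 - z)\<close> map the unit disc into itself, and at \<open>z = 0\<close> it turns \<open>\<phi>(c)\<close>
  into \<open>0\<close> and \<open>\<phi>(a)\<close> into a nonnegative number. After the common prefix of \<open>u\<close> and \<open>v\<close> has been
  factored out, the difference \<open>G(z)\<close> of the two sums therefore satisfies \<open>\<bar>G(0)\<bar> \<ge> 1\<close> for one of
  the letters \<open>l\<close>, and \<open>\<bar>G(z)\<bar> \<le> 2 / (\<delta> (1 - \<bar>z\<bar>))\<close> in the unit disc.

  It remains to find a point \<open>z\<close> close to \<open>1\<close> where \<open>G\<close> is not too small: there \<open>w\<close> is close to \<open>1\<close>
  as well, and neither the powers of \<open>w\<close> nor the factor of the common prefix cost too much.
  The curve \<open>z = \<zeta> (1 + \<zeta>) / 2\<close>, \<open>\<bar>\<zeta>\<bar> = 1\<close>, touches the unit circle only at \<open>1\<close>, to second order,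
  so that \<open>Q(\<zeta>) = G(z) (1 - \<zeta>)\<^sup>2\<close> is bounded by \<open>16 / \<delta>\<close> on the unit circle, uniformly in \<open>n\<close>.
  The maximum principle for the product of \<open>Q\<close> over \<open>M\<close> equally spaced rotations
  (\<open>large_value_near_one\<close>) gives a point with \<open>\<bar>1 - \<zeta>\<bar> \<le> 2\<pi> / M\<close> and \<open>\<bar>Q(\<zeta>)\<bar> \<ge> (\<delta> / 16)\<^bsup>M - 1\<^esup>\<close>.
  Up to a factor \<open>O(n)\<close>, all other losses are of the form \<open>exp (O(n / M\<^sup>2))\<close>;
  the choice \<open>M \<approx> 20 n\<^bsup>1/3\<^esup>\<close> balances the two.

  Now let the probabilities differ. The number of occurrences of a letter \<open>t\<close> in the trace
  is binomial with mean \<open>\<mu>\<close> and second moment \<open>\<mu> (1 - p t + \<mu>)\<close>. If these statistics nearly agree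
  for two candidates, then the probabilities of all relevant letters nearly agree
  (\<open>retention_prob_from_moments\<close>). Since expected statistics are Lipschitz in \<open>p\<close>
  (\<open>trace_mean_Lipschitz\<close>), the comparison reduces to equal probabilities.
\<close>

section \<open>The deletion channel as a recursion over the input\<close>

text \<open>
  Splitting off the coin of the first entry, instead of the last one, turns the channel into a
  recursion over the input list.
\<close>

lemma Pi_pmf_lessThan_Suc_shift:
  "Pi_pmf {..<Suc n} d f =
     bind_pmf (f 0) (\<lambda>b. map_pmf (case_nat b) (Pi_pmf {..<n} d (\<lambda>k. f (Suc k))))"
proof (induction n)
  case 0
  have "case_nat b (\<lambda>_. d) = (\<lambda>_. d)(0 := b)" for b
    by (auto simp: fun_eq_iff split: nat.splits)
  moreover have "{..<Suc 0} = insert 0 {}" by auto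
  ultimately show ?case
    using Pi_pmf_insert'[of "{}" 0 d f] by (simp add: bind_return_pmf)
next
  case (Suc n)
  have upd: "(case_nat b g)(Suc n := y) = case_nat b (g(n := y))" for b y and g :: "nat \<Rightarrow> 'a"
    by (auto simp: fun_eq_iff split: nat.splits)
  have "Pi_pmf {..<Suc (Suc n)} d f =
      bind_pmf (f (Suc n)) (\<lambda>y. bind_pmf (f 0) (\<lambda>b.
        bind_pmf (Pi_pmf {..<n} d (\<lambda>k. f (Suc k))) (\<lambda>g. return_pmf (case_nat b (g(n := y))))))"
    unfolding lessThan_Suc[of "Suc n"]
    by (subst Pi_pmf_insert')
       (simp_all add: Suc map_pmf_def bind_assoc_pmf bind_return_pmf upd)
  also have "\<dots> = bind_pmf (f 0) (\<lambda>b. bind_pmf (f (Suc n)) (\<lambda>y.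
        bind_pmf (Pi_pmf {..<n} d (\<lambda>k. f (Suc k))) (\<lambda>g. return_pmf (case_nat b (g(n := y))))))"
    by (rule bind_commute_pmf)
  also have "\<dots> = bind_pmf (f 0) (\<lambda>b. map_pmf (case_nat b) (Pi_pmf {..<Suc n} d (\<lambda>k. f (Suc k))))"
    unfolding lessThan_Suc[of n]
    by (subst Pi_pmf_insert') (simp_all add: map_pmf_def bind_assoc_pmf bind_return_pmf)
  finally show ?case .
qed

lemma deletion_channel_Nil [simp]: "deletion_channel p [] = return_pmf []"
  by (simp add: deletion_channel_def)

lemma deletion_channel_Cons:
  "deletion_channel p (x # xs) = bind_pmf (bernoulli_pmf (p x))
     (\<lambda>b. map_pmf (\<lambda>ys. if b then x # ys else ys) (deletion_channel p xs))"
proof -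
  have "nths (x # xs) {k. case_nat b g k} = (if b then x # nths xs {k. g k} else nths xs {k. g k})"
    for b g by (simp add: nths_Cons)
  then show ?thesis
    unfolding deletion_channel_def
    by (simp add: Pi_pmf_lessThan_Suc_shift map_bind_pmf pmf.map_comp o_def)
qed

lemma finite_set_deletion_channel [simp]: "finite (set_pmf (deletion_channel p xs))"
  by (induction xs) (auto simp: deletion_channel_Cons)

text \<open>
  Coins are independent, so those of the removed letters can be ignored. This lets the
  analysis concentrate on two letters at a time.
\<close>

lemma deletion_channel_filter:
  "map_pmf (filter P) (deletion_channel p xs) = deletion_channel p (filter P xs)"
proof (induction xs)
  case (Cons x xs)
  have "map_pmf (\<lambda>ys. filter P (if b then x # ys else ys)) (deletion_channel p xs) =
    map_pmf (\<lambda>ys. if P x \<and> b then x # ys else ys) (map_pmf (filter P) (deletion_channel p xs))" for b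
    by (auto simp: pmf.map_comp o_def intro!: pmf.map_cong)
  then show ?case
    by (auto simp: deletion_channel_Cons map_bind_pmf pmf.map_comp o_def Cons
        map_pmf_ident bind_pmf_const)
qed simp

lemma set_deletion_channel_subset:
  "ys \<in> set_pmf (deletion_channel p xs) \<Longrightarrow> set ys \<subseteq> set xs \<and> length ys \<le> length xs"
  by (induction xs arbitrary: ys)
     (fastforce simp: deletion_channel_Cons split: if_splits)+

lemma set_deletion_channel_traces:
  assumes "x \<in> strings m n" shows "set_pmf (deletion_channel p x) \<subseteq> traces m n"
  using set_deletion_channel_subset[of _ p x] assms
  by (fastforce simp: traces_def strings_def)

definition trace_mean :: "(nat \<Rightarrow> real) \<Rightarrow> nat list \<Rightarrow> (nat list \<Rightarrow> 'b) \<Rightarrow> 'b::{banach, second_countable_topology}"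
  where "trace_mean p x f = measure_pmf.expectation (deletion_channel p x) f"

lemma trace_mean_Nil [simp]: "trace_mean p [] f = f []"
  by (simp add: trace_mean_def)

lemma trace_mean_Cons:
  assumes "0 \<le> p x" "p x \<le> 1"
  shows "trace_mean p (x # xs) f =
    p x *\<^sub>R trace_mean p xs (\<lambda>ys. f (x # ys)) + (1 - p x) *\<^sub>R trace_mean p xs f"
  unfolding trace_mean_def deletion_channel_Cons
  by (subst pmf_expectation_bind[of UNIV]) (use assms in \<open>auto simp: UNIV_bool\<close>)

lemma trace_mean_add: "trace_mean p x (\<lambda>ys. f ys + g ys) = trace_mean p x f + trace_mean p x g"
  unfolding trace_mean_def by (intro Bochner_Integration.integral_add integrable_measure_pmf_finite) simp_all

lemma trace_mean_sum: "trace_mean p x (\<lambda>ys. \<Sum>i\<in>I. f i ys) = (\<Sum>i\<in>I. trace_mean p x (f i))"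
  unfolding trace_mean_def by (intro Bochner_Integration.integral_sum integrable_measure_pmf_finite) simp_all

lemma trace_mean_mult:
  fixes c :: "'a::{real_normed_field, banach, second_countable_topology}"
  shows "trace_mean p x (\<lambda>ys. c * f ys) = c * trace_mean p x f"
  unfolding trace_mean_def by (rule integral_mult_right_zero)

lemma trace_mean_of_real:
  "trace_mean p x (\<lambda>ys. complex_of_real (f ys)) = complex_of_real (trace_mean p x f)"
  unfolding trace_mean_def by simp

lemma trace_mean_const [simp]: "trace_mean p x (\<lambda>_. c) = c"
  by (simp add: trace_mean_def)

lemma trace_mean_filter: "trace_mean p x (\<lambda>ys. f (filter P ys)) = trace_mean p (filter P x) f"
  by (simp add: trace_mean_def flip: deletion_channel_filter)

lemma trace_mean_cong:
  "(\<And>ys. set ys \<subseteq> set x \<Longrightarrow> length ys \<le> length x \<Longrightarrow> f ys = g ys) \<Longrightarrow> trace_mean p x f = trace_mean p x g"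
  unfolding trace_mean_def
  by (intro integral_cong_AE) (auto simp: AE_measure_pmf_iff dest: set_deletion_channel_subset)

lemma trace_mean_bounds:
  fixes f :: "nat list \<Rightarrow> real"
  assumes "\<And>ys. 0 \<le> f ys \<and> f ys \<le> 1"
  shows "0 \<le> trace_mean p x f" "trace_mean p x f \<le> 1"
proof -
  show "0 \<le> trace_mean p x f"
    unfolding trace_mean_def by (rule integral_nonneg_AE) (use assms in auto)
  have "trace_mean p x f \<le> measure_pmf.expectation (deletion_channel p x) (\<lambda>_. 1)"
    unfolding trace_mean_def
    by (intro integral_mono integrable_measure_pmf_finite) (use assms in auto)
  then show "trace_mean p x f \<le> 1" by simp
qed

text \<open>
  Changing the probability of one coin by \<open>h\<close> changes the mean of a \<open>[0, 1]\<close>-valued statistic by at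
  most \<open>h\<close>; the input is read letter by letter.
\<close>

lemma trace_mean_Lipschitz:
  fixes f :: "nat list \<Rightarrow> real"
  assumes "\<And>ys. 0 \<le> f ys \<and> f ys \<le> 1"
    and "\<And>t. t \<in> set x \<Longrightarrow> 0 \<le> p t \<and> p t \<le> 1 \<and> 0 \<le> p' t \<and> p' t \<le> 1 \<and> \<bar>p t - p' t\<bar> \<le> h"
  shows "\<bar>trace_mean p x f - trace_mean p' x f\<bar> \<le> real (length x) * h"
  using assms
proof (induction x arbitrary: f)
  case (Cons t x)
  let ?g = "\<lambda>ys. f (t # ys)"
  have t: "0 \<le> p t" "p t \<le> 1" "0 \<le> p' t" "p' t \<le> 1" "\<bar>p t - p' t\<bar> \<le> h"
    using Cons.prems(2)[of t] by auto
  have A: "\<bar>trace_mean p x ?g - trace_mean p' x ?g\<bar> \<le> real (length x) * h"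
    and B: "\<bar>trace_mean p x f - trace_mean p' x f\<bar> \<le> real (length x) * h"
    using Cons.prems by (intro Cons.IH; force)+
  have "\<bar>trace_mean p' x ?g - trace_mean p' x f\<bar> \<le> 1"
    using trace_mean_bounds[of f p' x] trace_mean_bounds[of ?g p' x] Cons.prems(1) by fastforce
  then have C: "\<bar>(p t - p' t) * (trace_mean p' x ?g - trace_mean p' x f)\<bar> \<le> h * 1"
    unfolding abs_mult using t by (intro mult_mono) auto
  have "trace_mean p (t # x) f - trace_mean p' (t # x) f =
      p t * (trace_mean p x ?g - trace_mean p' x ?g) + (1 - p t) * (trace_mean p x f - trace_mean p' x f)
      + (p t - p' t) * (trace_mean p' x ?g - trace_mean p' x f)"
    using t by (simp add: trace_mean_Cons algebra_simps)
  moreover have "\<bar>p t * (trace_mean p x ?g - trace_mean p' x ?g)\<bar> \<le> p t * (real (length x) * h)"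
    and "\<bar>(1 - p t) * (trace_mean p x f - trace_mean p' x f)\<bar> \<le> (1 - p t) * (real (length x) * h)"
    unfolding abs_mult using t A B by (auto intro!: mult_left_mono)
  ultimately have "\<bar>trace_mean p (t # x) f - trace_mean p' (t # x) f\<bar> \<le>
      p t * (real (length x) * h) + (1 - p t) * (real (length x) * h) + h"
    using C by linarith
  then show ?case by (simp add: algebra_simps)
qed simp

text \<open>
  The count of \<open>a\<close> in a trace is binomially distributed.
\<close>

lemma trace_mean_count:
  assumes "0 \<le> p a" "p a \<le> 1" "\<And>t. t \<in> set x \<Longrightarrow> 0 \<le> p t \<and> p t \<le> 1"
  shows "trace_mean p x (\<lambda>ys. real (count_list ys a)) = real (count_list x a) * p a" (is ?first)
    and "trace_mean p x (\<lambda>ys. (real (count_list ys a))\<^sup>2) =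
      (real (count_list x a) * p a) * (1 - p a + real (count_list x a) * p a)" (is ?second)
proof -
  have 1: "trace_mean p x (\<lambda>ys. real (count_list ys a)) = real (count_list x a) * p a"
    if "\<And>t. t \<in> set x \<Longrightarrow> 0 \<le> p t \<and> p t \<le> 1" for x
    using that by (induction x) (auto simp: trace_mean_Cons trace_mean_add algebra_simps)
  show ?first using 1 assms by blast
  show ?second
    using assms(3)
  proof (induction x)
    case (Cons t x)
    have sq: "(1 + real k)\<^sup>2 = (real k)\<^sup>2 + 2 * real k + 1" for k
      by (simp add: power2_eq_square algebra_simps)
    show ?case
      using Cons 1[of x]
      by (auto simp: trace_mean_Cons sq trace_mean_add trace_mean_mult)
         (simp_all add: algebra_simps power2_eq_square)
  qed simp
qed

section \<open>Generating functions of letter positions\<close>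

text \<open>
  The value is \<open>\<Sum>k | xs ! k = l. \<Prod>j<k. \<phi> (xs ! j)\<close>. With the constant weight \<open>w\<close> it is the
  generating function of the positions of \<open>l\<close> in \<open>xs\<close>; letter-dependent weights describe its mean over
  the traces.
\<close>

primrec occurrence_sum :: "(nat \<Rightarrow> complex) \<Rightarrow> nat \<Rightarrow> nat list \<Rightarrow> complex" where
  "occurrence_sum \<phi> l [] = 0"
| "occurrence_sum \<phi> l (x # xs) = of_bool (x = l) + \<phi> x * occurrence_sum \<phi> l xs"

definition letter_at :: "nat \<Rightarrow> nat \<Rightarrow> nat list \<Rightarrow> real" where
  "letter_at l k xs = of_bool (k < length xs \<and> xs ! k = l)"

lemma occurrence_sum_const:
  "length xs \<le> n \<Longrightarrow> occurrence_sum (\<lambda>_. w) l xs = (\<Sum>k<n. w ^ k * of_real (letter_at l k xs))"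
proof (induction xs arbitrary: n)
  case (Cons x xs)
  then obtain n' where "n = Suc n'" "length xs \<le> n'" by (cases n) auto
  then show ?case
    using Cons.IH[of n']
    by (simp add: letter_at_def sum.lessThan_Suc_shift sum_distrib_left mult.assoc del: sum.lessThan_Suc)
qed (simp add: letter_at_def)

text \<open>
  A retained letter \<open>t\<close> shifts all later letters by one position and contributes a factor \<open>w\<close>, a
  deleted one contributes \<open>1\<close>; the mean factor is \<open>1 - p t + p t * w\<close>. Taking the mean over
  traces thus replaces the constant weight \<open>w\<close> by this letter-dependent weight.
\<close>

lemma trace_mean_occurrence_sum:
  assumes "\<And>t. t \<in> set xs \<Longrightarrow> 0 \<le> p t \<and> p t \<le> 1"
  shows "trace_mean p xs (occurrence_sum (\<lambda>_. w) l) =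
    of_real (p l) * occurrence_sum (\<lambda>t. 1 - of_real (p t) * (1 - w)) l xs"
  using assms
proof (induction xs)
  case (Cons x xs)
  then show ?case
    by (simp add: trace_mean_Cons trace_mean_add trace_mean_mult scaleR_conv_of_real algebra_simps)
qed simp

lemma occurrence_sum_common_prefix:
  "occurrence_sum \<phi> l (ps @ u) - occurrence_sum \<phi> l (ps @ v) =
    prod_list (map \<phi> ps) * (occurrence_sum \<phi> l u - occurrence_sum \<phi> l v)"
  by (induction ps) (simp_all flip: right_diff_distrib)

lemma norm_occurrence_sum_le:
  assumes "0 \<le> \<rho>" "\<rho> < 1" "\<And>t. t \<in> set xs \<Longrightarrow> norm (\<phi> t) \<le> \<rho>"
  shows "norm (occurrence_sum \<phi> l xs) \<le> 1 / (1 - \<rho>)"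
  using assms(3)
proof (induction xs)
  case (Cons x xs)
  have "norm (occurrence_sum \<phi> l (x # xs)) \<le>
      norm (of_bool (x = l) :: complex) + norm (\<phi> x * occurrence_sum \<phi> l xs)"
    by (simp add: norm_triangle_ineq)
  also have "\<dots> \<le> 1 + \<rho> * (1 / (1 - \<rho>))"
    unfolding norm_mult using Cons assms(1,2)
    by (intro add_mono mult_mono) auto
  also have "\<dots> = 1 / (1 - \<rho>)" using assms(2) by (simp add: field_simps)
  finally show ?case .
qed (use assms in simp)

lemma occurrence_sum_nonneg:
  assumes "\<And>t. t \<in> set xs \<Longrightarrow> \<exists>s\<ge>0. \<phi> t = of_real s"
  shows "\<exists>s\<ge>0. occurrence_sum \<phi> l xs = of_real s"
  using assms
proof (induction xs)
  case (Cons x xs)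
  then obtain s s' where "s \<ge> 0" "occurrence_sum \<phi> l xs = of_real s" "s' \<ge> 0" "\<phi> x = of_real s'"
    by (metis list.set_intros)
  then show ?case
    by (intro exI[of _ "of_bool (x = l) + s' * s"]) simp
qed (auto intro!: exI[of _ 0])

lemma norm_occurrence_sum_hd:
  assumes "\<And>t. t \<in> set (l # xs) \<Longrightarrow> \<exists>s\<ge>0. \<phi> t = of_real s"
  shows "1 \<le> norm (occurrence_sum \<phi> l (l # xs))"
proof -
  obtain s s' where s: "s \<ge> 0" "occurrence_sum \<phi> l xs = of_real s" "s' \<ge> 0" "\<phi> l = of_real s'"
    using occurrence_sum_nonneg[of xs \<phi> l] assms by (metis list.set_intros)
  then have "occurrence_sum \<phi> l (l # xs) = of_real (1 + s' * s)" by simp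
  then show ?thesis using s by (metis abs_ge_self norm_of_real le_add_same_cancel1 mult_nonneg_nonneg order_trans)
qed

text \<open>
  A letter \<open>c\<close> of weight \<open>0\<close> hides everything after it. If one string begins with \<open>c\<close> and the other with
  \<open>a\<close>, then the positions of \<open>a\<close> contribute nothing for the former and at least \<open>1\<close> for the latter. If one
  string is empty, the first letter of the other one serves.
\<close>

lemma occurrence_sums_differ_at_zero:
  assumes "u \<noteq> v" "u = [] \<or> v = [] \<or> hd u \<noteq> hd v"
    and sub: "set u \<subseteq> {a, c}" "set v \<subseteq> {a, c}"
    and "\<phi> c = 0" "\<exists>s\<ge>0. \<phi> a = of_real s"
  shows "\<exists>l\<in>{a, c}. 1 \<le> norm (occurrence_sum \<phi> l u - occurrence_sum \<phi> l v)"
proof -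
  have nn: "\<exists>s\<ge>0. \<phi> t = of_real s" if "t \<in> {a, c}" for t
    using that assms(5,6) by (auto intro: exI[of _ 0])
  have hd1: "1 \<le> norm (occurrence_sum \<phi> l (l # xs))" if "set (l # xs) \<subseteq> {a, c}" for l xs
    by (rule norm_occurrence_sum_hd) (use that nn in blast)
  have c0: "occurrence_sum \<phi> a (c # xs) = 0" if "a \<noteq> c" for xs
    using that assms(5) by simp
  show ?thesis
  proof (cases u)
    case Nil
    then obtain l v' where "v = l # v'" using assms(1) by (cases v) auto
    moreover from this have "1 \<le> norm (0 - occurrence_sum \<phi> l (l # v'))"
      using hd1[of l v'] sub by (simp del: occurrence_sum.simps)
    ultimately show ?thesis using sub Nil by (intro bexI[of _ l]) auto
  next
    case u: (Cons l u')
    show ?thesis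
    proof (cases v)
      case Nil
      then show ?thesis using hd1[of l u'] sub u by (intro bexI[of _ l]) auto
    next
      case v: (Cons k v')
      have "l \<noteq> k" using assms(2) u v by simp
      then consider "l = a" "k = c" | "l = c" "k = a" using sub u v by auto
      then show ?thesis
      proof cases
        case 1
        then show ?thesis using hd1[of a u'] c0[of v'] \<open>l \<noteq> k\<close> sub u v by (intro bexI[of _ a]) auto
      next
        case 2
        have "1 \<le> norm (0 - occurrence_sum \<phi> a (a # v'))"
          using hd1[of a v'] 2 sub v by (simp del: occurrence_sum.simps)
        then show ?thesis using 2 c0[of u'] \<open>l \<noteq> k\<close> u v by (intro bexI[of _ a]) auto
      qed
    qed
  qed
qed

lemma holomorphic_occurrence_sum:
  "(\<And>t. (\<lambda>z. \<phi> z t) holomorphic_on A) \<Longrightarrow> (\<lambda>z. occurrence_sum (\<phi> z) l xs) holomorphic_on A"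
  by (induction xs) (auto intro!: holomorphic_intros)

section \<open>Large values of a holomorphic function near a boundary point\<close>

lemma rotate_near_one:
  assumes "norm \<zeta> = 1" "0 < M"
  shows "\<exists>j<M. norm (1 - \<zeta> * cis (2 * pi * real j / real M)) \<le> 2 * pi / real M"
proof -
  obtain \<tau> where \<tau>: "0 \<le> \<tau>" "\<tau> < 2 * pi" "\<zeta> = cis \<tau>"
    using assms(1) by (metis Arg2pi_eq Arg2pi_ge_0 Arg2pi_lt_2pi cis_conv_exp mult.commute mult_1 of_real_1)
  define k where "k = nat \<lfloor>\<tau> * M / (2 * pi)\<rfloor>"
  have k: "real k \<le> \<tau> * M / (2 * pi)" "\<tau> * M / (2 * pi) < real k + 1"
    unfolding k_def using \<tau> by (auto simp: of_nat_nat)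
  have "\<tau> * M / (2 * pi) < M" using \<tau> assms(2) by (simp add: field_simps)
  then have "k < M" using k by linarith
  \<comment> \<open>The rotation that turns the sector of \<open>\<zeta>\<close> back to the one starting at \<open>1\<close>; for \<open>k = 0\<close>
    the reduction modulo \<open>M\<close> gives the trivial rotation.\<close>
  define j where "j = (M - k) mod M"
  have cj: "cis (2 * pi * real j / real M) = cis (- 2 * pi * real k / real M)"
  proof (cases "k = 0")
    case False
    then have "real j = real M - real k" using \<open>k < M\<close> by (simp add: j_def)
    then have "2 * pi * real j / real M = 2 * pi + (- 2 * pi * real k / real M)"
      using assms(2) by (simp add: diff_divide_distrib right_diff_distrib)
    then show ?thesis by (simp only: cis_mult[symmetric] cis_2pi mult_1)
  qed (simp add: j_def)
  define \<theta> where "\<theta> = \<tau> - 2 * pi * real k / real M"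
  have th: "0 \<le> \<theta>" "\<theta> \<le> 2 * pi / M"
  proof -
    have "2 * pi * real k / real M \<le> \<tau>" "\<tau> \<le> (2 * pi * real k + 2 * pi) / real M"
      using k assms(2) by (simp_all add: field_simps)
    then show "0 \<le> \<theta>" "\<theta> \<le> 2 * pi / M"
      by (simp_all add: \<theta>_def add_divide_distrib)
  qed
  have "norm (1 - cis \<theta>) \<le> \<bar>\<theta>\<bar>"
    using dist_exp_i_1[of \<theta>] abs_sin_x_le_abs_x[of "\<theta> / 2"]
    by (simp add: cis_conv_exp norm_minus_commute)
  moreover have "\<zeta> * cis (2 * pi * real j / real M) = cis \<theta>"
    unfolding cj \<tau>(3) by (simp add: cis_mult \<theta>_def)
  moreover have "j < M" using assms(2) by (simp add: j_def)
  ultimately show ?thesis using th by (intro exI[of _ j]) auto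
qed

text \<open>
  On the unit circle, each factor of the product of \<open>Q\<close> over \<open>M\<close> rotations is at most \<open>K\<close>, and one of
  them is evaluated within \<open>2\<pi> / M\<close> of \<open>1\<close>. If \<open>Q\<close> were too small there, the product would contradict the
  maximum principle, because it is at least \<open>1\<close> in modulus at the centre.
\<close>

lemma large_value_near_one:
  fixes Q :: "complex \<Rightarrow> complex"
  assumes hol: "Q holomorphic_on UNIV" and bound: "\<And>\<zeta>. norm \<zeta> = 1 \<Longrightarrow> norm (Q \<zeta>) \<le> K"
    and "1 \<le> norm (Q 0)" "0 < M"
  shows "\<exists>\<zeta>. norm \<zeta> = 1 \<and> norm (1 - \<zeta>) \<le> 2 * pi / real M \<and> 1 \<le> K ^ (M - 1) * norm (Q \<zeta>)"
proof -
  define N where "N = {\<zeta>::complex. norm \<zeta> = 1 \<and> norm (1 - \<zeta>) \<le> 2 * pi / real M}"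
  have N: "N = sphere 0 1 \<inter> cball 1 (2 * pi / real M)" by (auto simp: N_def dist_norm)
  have "compact N" unfolding N by (simp add: compact_Int_closed)
  moreover have "1 \<in> N" using assms(4) by (simp add: N_def)
  moreover have "continuous_on N (\<lambda>\<zeta>. norm (Q \<zeta>))"
    using hol by (intro continuous_intros holomorphic_on_imp_continuous_on) (auto intro: holomorphic_on_subset)
  ultimately obtain \<zeta>0 where z0: "\<zeta>0 \<in> N" "\<And>\<zeta>. \<zeta> \<in> N \<Longrightarrow> norm (Q \<zeta>) \<le> norm (Q \<zeta>0)"
    using continuous_attains_sup[of N "\<lambda>\<zeta>. norm (Q \<zeta>)"] by blast
  define F where "F \<zeta> = (\<Prod>j<M. Q (\<zeta> * cis (2 * pi * real j / real M)))" for \<zeta>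
  have "Q \<circ> (\<lambda>\<zeta>. \<zeta> * cis (2 * pi * real j / real M)) holomorphic_on UNIV" for j
    by (rule holomorphic_on_compose_gen[OF _ hol]) (auto intro!: holomorphic_intros)
  then have holF: "F holomorphic_on A" for A
    unfolding F_def o_def by (intro holomorphic_on_prod) (auto intro: holomorphic_on_subset)
  have "norm (F 0) \<le> K ^ (M - 1) * norm (Q \<zeta>0)"
  proof (rule maximum_modulus_frontier[of F "cball 0 1"])
    fix \<zeta> :: complex assume "\<zeta> \<in> frontier (cball 0 1)"
    then have 1: "norm \<zeta> = 1" by simp
    define R where "R j = \<zeta> * cis (2 * pi * real j / real M)" for j
    have R1: "norm (R j) = 1" for j by (simp add: R_def norm_mult 1)
    obtain j where j: "j < M" "R j \<in> N"
      using rotate_near_one[OF 1 assms(4)] R1 by (auto simp: N_def R_def)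
    have "norm (F \<zeta>) = norm (Q (R j)) * (\<Prod>i\<in>{..<M} - {j}. norm (Q (R i)))"
      using j(1) by (simp add: F_def R_def prod_norm[symmetric] prod.remove norm_mult)
    also have "\<dots> \<le> norm (Q \<zeta>0) * (\<Prod>i\<in>{..<M} - {j}. K)"
      using z0(2)[OF j(2)] bound[OF R1] by (intro mult_mono prod_mono prod_nonneg) auto
    also have "\<dots> = K ^ (M - 1) * norm (Q \<zeta>0)"
      using j(1) by simp
    finally show "norm (F \<zeta>) \<le> K ^ (M - 1) * norm (Q \<zeta>0)" .
  qed (auto intro!: holF holomorphic_on_imp_continuous_on)
  moreover have "norm (F 0) = norm (Q 0) ^ M" by (simp add: F_def norm_power)
  moreover have "1 \<le> norm (Q 0) ^ M" using assms(3) by simp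
  ultimately show ?thesis using z0(1) by (auto simp: N_def)
qed

section \<open>Separating two strings over two letters\<close>

lemma strip_common_prefix:
  "\<exists>ps u' v'. u = ps @ u' \<and> v = ps @ v' \<and> (u' = [] \<or> v' = [] \<or> hd u' \<noteq> hd v')"
proof (induction u arbitrary: v)
  case (Cons x u)
  show ?case
  proof (cases "v \<noteq> [] \<and> hd v = x")
    case True
    then obtain v1 where v1: "v = x # v1" by (cases v) auto
    then obtain ps u' v' where "u = ps @ u' \<and> v1 = ps @ v' \<and> (u' = [] \<or> v' = [] \<or> hd u' \<noteq> hd v')"
      using Cons.IH by blast
    then have "x # u = (x # ps) @ u' \<and> v = (x # ps) @ v' \<and> (u' = [] \<or> v' = [] \<or> hd u' \<noteq> hd v')"
      using v1 by simp
    then show ?thesis by blast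
  next
    case False
    then have "x # u = [] @ (x # u) \<and> v = [] @ v \<and> (x # u = [] \<or> v = [] \<or> hd (x # u) \<noteq> hd v)"
      by auto
    then show ?thesis by blast
  qed
qed simp

text \<open>
  Both the weight of a letter, as a function of \<open>z\<close>, and the variable \<open>w\<close> have this form, with \<open>r \<le> 1\<close>
  and \<open>r \<ge> 1\<close> respectively. The modulus near \<open>z = 1\<close> differs from \<open>1\<close> only to
  the order of \<open>Re (1 - z)\<close> and \<open>\<bar>1 - z\<bar>\<^sup>2\<close>.
\<close>

lemma norm_affine_squared:
  "(norm (1 - of_real r * (1 - z)))\<^sup>2 = 1 - 2 * r * Re (1 - z) + r\<^sup>2 * (norm (1 - z))\<^sup>2"
  unfolding cmod_power2 by (simp add: power2_eq_square algebra_simps)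

text \<open>
  The curve lies in the unit disc at distance of order \<open>s\<^sup>2\<close> from the circle, which tames the
  singularity \<open>1 / (1 - \<bar>z\<bar>)\<close>. It leaves \<open>1\<close> tangentially to the circle: \<open>Re (1 - z)\<close> is of
  order \<open>s\<^sup>2\<close> although \<open>1 - z\<close> is of order \<open>s\<close>.
\<close>

lemma inner_curve_estimates:
  assumes "norm \<zeta> = 1"
  defines "z \<equiv> \<zeta> * (1 + \<zeta>) / 2" and "s \<equiv> norm (1 - \<zeta>)"
  shows "norm z \<le> 1 - s\<^sup>2 / 8" "Re (1 - z) \<le> 5 / 4 * s\<^sup>2" "0 \<le> Re (1 - z)" "(norm (1 - z))\<^sup>2 \<le> 9 / 4 * s\<^sup>2"
    "s\<^sup>2 \<le> 4"
proof -
  have unit: "(Re \<zeta>)\<^sup>2 + (Im \<zeta>)\<^sup>2 = 1" using assms(1) by (simp flip: cmod_power2)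
  have s2: "s\<^sup>2 = 2 * (1 - Re \<zeta>)"
    unfolding s_def cmod_power2 using unit by (simp add: power2_eq_square algebra_simps)
  have x: "-1 \<le> Re \<zeta>" "Re \<zeta> \<le> 1"
    using abs_Re_le_cmod[of \<zeta>] assms(1) by auto
  show "s\<^sup>2 \<le> 4" using s2 x by simp
  have "(norm (1 + \<zeta>))\<^sup>2 = 4 - s\<^sup>2"
    unfolding s2 cmod_power2 using unit by (simp add: power2_eq_square algebra_simps)
  moreover have "norm z = norm (1 + \<zeta>) / 2" by (simp add: z_def norm_mult norm_divide assms(1))
  ultimately have "(norm z)\<^sup>2 = (4 - s\<^sup>2) / 2\<^sup>2" by (simp only: power_divide)
  then have "(norm z)\<^sup>2 = 1 - s\<^sup>2 / 4" by simp
  also have "\<dots> \<le> 1 - s\<^sup>2 / 4 + (s\<^sup>2 / 8)\<^sup>2" by simp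
  also have "\<dots> = (1 - s\<^sup>2 / 8)\<^sup>2" by (simp add: power2_diff)
  finally show "norm z \<le> 1 - s\<^sup>2 / 8"
    by (rule power2_le_imp_le) (use \<open>s\<^sup>2 \<le> 4\<close> in simp)
  have Im2: "(Im \<zeta>)\<^sup>2 = 1 - (Re \<zeta>)\<^sup>2" using unit by simp
  have "Re (1 - z) = (2 - Re \<zeta> - (Re \<zeta>)\<^sup>2 + (Im \<zeta>)\<^sup>2) / 2"
    by (simp add: z_def power2_eq_square field_simps)
  then have Re: "Re (1 - z) = (1 - Re \<zeta>) * (3 + 2 * Re \<zeta>) / 2"
    unfolding Im2 by (simp add: power2_eq_square algebra_simps)
  show "0 \<le> Re (1 - z)"
  proof -
    have "(norm z)\<^sup>2 \<le> 1" using \<open>(norm z)\<^sup>2 = 1 - s\<^sup>2 / 4\<close> by simp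
    then have "norm z \<le> 1" by (simp add: power2_le_imp_le abs_square_le_1)
    then show ?thesis using complex_Re_le_cmod[of z] by simp
  qed
  have "(1 - Re \<zeta>) * (3 + 2 * Re \<zeta>) \<le> (1 - Re \<zeta>) * 5" using x by (intro mult_left_mono) auto
  then show "Re (1 - z) \<le> 5 / 4 * s\<^sup>2" unfolding Re s2 by simp
  have "1 - z = (1 - \<zeta>) * (2 + \<zeta>) / 2" by (simp add: z_def field_simps)
  then have "norm (1 - z) = norm ((1 - \<zeta>) * (2 + \<zeta>) / 2)" by (simp only:)
  also have "\<dots> = s * norm (2 + \<zeta>) / 2" unfolding s_def norm_mult norm_divide by simp
  also have "\<dots> \<le> s * 3 / 2"
    using norm_triangle_ineq[of 2 \<zeta>] assms(1)
    by (intro divide_right_mono mult_left_mono) (auto simp: s_def)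
  finally have "norm (1 - z) \<le> 3 / 2 * s" by simp
  then have "(norm (1 - z))\<^sup>2 \<le> (3 / 2 * s)\<^sup>2" by (intro power_mono) auto
  then show "(norm (1 - z))\<^sup>2 \<le> 9 / 4 * s\<^sup>2" by (simp add: power2_eq_square)
qed

lemma exp_minus_le_affine: "0 \<le> y \<Longrightarrow> y \<le> 1 / 2 \<Longrightarrow> exp (- 2 * y) \<le> 1 - (y::real)"
proof -
  assume y: "0 \<le> y" "y \<le> 1 / 2"
  have "1 + 2 * y \<le> exp (2 * y)" by simp
  moreover have "1 \<le> (1 - y) * (1 + 2 * y)"
  proof -
    have "0 \<le> y * (1 - 2 * y)" using y by (intro mult_nonneg_nonneg) auto
    then show ?thesis by (simp add: algebra_simps)
  qed
  ultimately have "1 \<le> (1 - y) * exp (2 * y)"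
    using y mult_left_mono[of "1 + 2 * y" "exp (2 * y)" "1 - y"] by linarith
  then show ?thesis by (simp add: exp_minus field_simps)
qed

text \<open>
  The summands collect the losses of \<open>two_letter_separation\<close>, each measured as an exponent of
  \<open>exp (n\<^bsup>1/3\<^esup>)\<close>: \<open>3\<close> for the number \<open>n\<close> of positions, \<open>1\<close> for the common prefix, \<open>1 / \<delta>\<^sup>2\<close> for
  the powers of \<open>w\<close>, \<open>320 / \<delta>\<close> for \<open>(16 / \<delta>)\<^bsup>M - 1\<^esup>\<close>, \<open>1 / \<delta>\<close> for the factor \<open>p l\<close>, and \<open>1\<close> to
  make a final inequality strict.
\<close>

definition separation_rate :: "real \<Rightarrow> real" where
  "separation_rate \<delta> = 5 + 1 / \<delta>\<^sup>2 + 321 / \<delta>"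

lemma le_exp_cube_root: "real n \<le> exp (3 * real n powr (1/3))"
proof (cases "n = 0")
  case False
  have "real n = (real n powr (1/3)) powr 3" using False by (simp add: powr_powr)
  also have "\<dots> = (real n powr (1/3)) ^ 3" using False by (simp add: powr_numeral)
  also have "\<dots> \<le> exp (real n powr (1/3)) ^ 3"
  proof (rule power_mono)
    show "real n powr (1/3) \<le> exp (real n powr (1/3))"
      using exp_ge_add_one_self[of "real n powr (1/3)"] by linarith
  qed simp
  finally show ?thesis by (simp flip: exp_of_nat_mult)
qed simp

lemma norm_prod_list_ge:
  fixes \<phi> :: "nat \<Rightarrow> complex"
  assumes "\<And>t. t \<in> set ps \<Longrightarrow> exp (- y) \<le> norm (\<phi> t)"
  shows "exp (- y * real (length ps)) \<le> norm (prod_list (map \<phi> ps))"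
  using assms
proof (induction ps)
  case (Cons t ps)
  have "exp (- y) * exp (- y * real (length ps)) \<le> norm (\<phi> t) * norm (prod_list (map \<phi> ps))"
    using Cons by (intro mult_mono) auto
  then show ?case by (simp add: norm_mult algebra_simps flip: exp_add)
qed simp

text \<open>
  The difference of the generating functions is computed at one well chosen point: it is large by the
  complex-analytic argument, and it is a combination of the differences of the letter probabilities, with
  coefficients that are powers of \<open>w\<close> and hence not too large.
\<close>

lemma two_letter_separation:
  assumes \<delta>: "0 < \<delta>" "\<delta> \<le> 1" and p: "\<And>t. t \<in> {a, c} \<Longrightarrow> \<delta> \<le> p t \<and> p t \<le> 1" and ac: "p a \<le> p c"
    and uv: "set u \<subseteq> {a, c}" "set v \<subseteq> {a, c}" "length u \<le> n" "length v \<le> n" "u \<noteq> v"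
  shows "\<exists>l\<in>{a, c}. \<exists>k<n. exp (- separation_rate \<delta> * real n powr (1/3)) \<le>
    \<bar>trace_mean p u (letter_at l k) - trace_mean p v (letter_at l k)\<bar>"
proof -
  obtain ps u' v' where pre: "u = ps @ u'" "v = ps @ v'" "u' = [] \<or> v' = [] \<or> hd u' \<noteq> hd v'"
    using strip_common_prefix by blast
  define N where "N = real n powr (1/3)"
  have "n \<noteq> 0" using uv by (metis le_zero_eq length_0_conv)
  then have N1: "N \<ge> 1" by (simp add: N_def ge_one_powr_ge_zero)
  have N3: "N ^ 3 = real n"
    using \<open>n \<noteq> 0\<close> by (simp add: N_def powr_powr flip: powr_numeral)
  define r where "r t = p t / p c" for t
  have pc: "\<delta> \<le> p c" "p c \<le> 1" "0 < p c" using p[of c] \<delta> by auto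
  have r: "\<delta> \<le> r t" "r t \<le> 1" if "t \<in> {a, c}" for t
  proof -
    have "\<delta> * p c \<le> \<delta> * 1" using \<delta> pc by (intro mult_left_mono) auto
    also have "\<dots> \<le> p t" using p that by auto
    finally show "\<delta> \<le> r t" unfolding r_def using pc by (simp add: field_simps)
    show "r t \<le> 1" unfolding r_def using pc ac that by auto
  qed
  define \<phi> where "\<phi> z t = 1 - of_real (r t) * (1 - z)" for z :: complex and t
  define G where "G l z = occurrence_sum (\<phi> z) l u' - occurrence_sum (\<phi> z) l v'" for l z
  obtain l where l: "l \<in> {a, c}" "1 \<le> norm (G l 0)"
  proof -
    have "\<phi> 0 c = 0" using pc by (simp add: \<phi>_def r_def)
    moreover have "\<exists>s\<ge>0. \<phi> 0 a = of_real s"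
      using r[of a] by (intro exI[of _ "1 - r a"]) (simp add: \<phi>_def)
    moreover have "u' \<noteq> v'" "set u' \<subseteq> {a, c}" "set v' \<subseteq> {a, c}" using uv pre by auto
    ultimately show ?thesis
      using occurrence_sums_differ_at_zero[of u' v' a c "\<phi> 0"] pre(3) that unfolding G_def by blast
  qed
  define Q where "Q \<zeta> = G l (\<zeta> * (1 + \<zeta>) / 2) * (1 - \<zeta>)\<^sup>2" for \<zeta>
  have holG: "G l holomorphic_on A" for A
    unfolding G_def \<phi>_def by (intro holomorphic_intros holomorphic_occurrence_sum)
  have "G l \<circ> (\<lambda>\<zeta>. \<zeta> * (1 + \<zeta>) / 2) holomorphic_on UNIV"
    by (rule holomorphic_on_compose_gen[OF _ holG[of UNIV]]) (auto intro!: holomorphic_intros)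
  then have holQ: "Q holomorphic_on UNIV"
    unfolding Q_def o_def by (intro holomorphic_intros)
  have boundQ: "norm (Q \<zeta>) \<le> 16 / \<delta>" if "norm \<zeta> = 1" for \<zeta>
  proof (cases "\<zeta> = 1")
    case False
    define z s where "z = \<zeta> * (1 + \<zeta>) / 2" and "s = norm (1 - \<zeta>)"
    have s: "s > 0" "s\<^sup>2 \<le> 4" "norm z \<le> 1 - s\<^sup>2 / 8"
      using inner_curve_estimates[OF that] False by (auto simp: z_def s_def)
    define \<rho> where "\<rho> = 1 - \<delta> * (s\<^sup>2 / 8)"
    have "\<delta> * (s\<^sup>2 / 8) \<le> 1 * 1" using \<delta> s by (intro mult_mono) auto
    then have \<rho>: "0 \<le> \<rho>" "\<rho> < 1" unfolding \<rho>_def using \<delta> s by auto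
    have "norm (\<phi> z t) \<le> \<rho>" if "t \<in> {a, c}" for t
    proof -
      have "\<phi> z t = of_real (1 - r t) + of_real (r t) * z" by (simp add: \<phi>_def algebra_simps)
      then have "norm (\<phi> z t) \<le> \<bar>1 - r t\<bar> + \<bar>r t\<bar> * norm z"
        by (metis norm_mult norm_of_real norm_triangle_ineq)
      also have "\<dots> \<le> (1 - r t) + r t * (1 - s\<^sup>2 / 8)"
        using r[OF that] \<delta> s by (intro add_mono mult_mono) auto
      also have "\<dots> = 1 - r t * (s\<^sup>2 / 8)" by (simp add: algebra_simps)
      also have "\<dots> \<le> \<rho>" unfolding \<rho>_def using r[OF that] by (intro diff_left_mono mult_right_mono) auto
      finally show ?thesis .
    qed
    then have "norm (occurrence_sum (\<phi> z) l u') \<le> 1 / (1 - \<rho>)" "norm (occurrence_sum (\<phi> z) l v') \<le> 1 / (1 - \<rho>)"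
      using uv pre by (auto intro!: norm_occurrence_sum_le \<rho>)
    then have "norm (G l z) \<le> 1 / (1 - \<rho>) + 1 / (1 - \<rho>)"
      unfolding G_def by (meson add_mono norm_triangle_ineq4 order_trans)
    then have "norm (G l z) \<le> 16 / (\<delta> * s\<^sup>2)" by (simp add: \<rho>_def)
    then have "norm (G l z) * s\<^sup>2 \<le> 16 / (\<delta> * s\<^sup>2) * s\<^sup>2" by (intro mult_right_mono) auto
    then show ?thesis using s by (simp add: Q_def z_def s_def norm_mult norm_power)
  qed (use \<delta> in \<open>simp add: Q_def\<close>)
  \<comment> \<open>The factor \<open>20\<close> gives \<open>s \<le> 2 / 5\<close> below, so that the weights of the prefix stay away
    from \<open>0\<close>; the size \<open>n\<^bsup>1/3\<^esup>\<close> balances \<open>M\<close> against \<open>n / M\<^sup>2\<close>.\<close>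
  define M where "M = nat \<lceil>20 * N\<rceil>"
  have M: "real M \<ge> 20 * N" "real (M - 1) \<le> 20 * N" "0 < M"
    using N1 unfolding M_def by linarith+
  obtain \<zeta> where z: "norm \<zeta> = 1" "norm (1 - \<zeta>) \<le> 2 * pi / real M" "1 \<le> (16 / \<delta>) ^ (M - 1) * norm (Q \<zeta>)"
    using large_value_near_one[OF holQ boundQ _ M(3)] l(2) by (auto simp: Q_def)
  define z s w where "z = \<zeta> * (1 + \<zeta>) / 2" and "s = norm (1 - \<zeta>)" and "w = 1 - (1 - z) / of_real (p c)"
  have est: "Re (1 - z) \<le> 5 / 4 * s\<^sup>2" "0 \<le> Re (1 - z)" "(norm (1 - z))\<^sup>2 \<le> 9 / 4 * s\<^sup>2"
    using inner_curve_estimates[OF z(1)] by (auto simp: z_def s_def)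
  have s0: "0 \<le> s" by (simp add: s_def)
  have "s \<le> 2 * pi / real M" using z(2) by (simp add: s_def)
  also have "\<dots> \<le> 8 / (20 * N)" using M N1 pi_less_4 by (intro frac_le) auto
  finally have "s \<le> 2 / 5 / N" by simp
  then have "s\<^sup>2 \<le> (2 / 5 / N)\<^sup>2" using s0 by (intro power_mono) auto
  then have sN: "s\<^sup>2 * N\<^sup>2 \<le> 4 / 25" using N1 by (simp add: power_divide field_simps)
  have s1: "s\<^sup>2 \<le> 4 / 25"
  proof -
    have "s\<^sup>2 * 1 \<le> s\<^sup>2 * N\<^sup>2" using N1 by (intro mult_left_mono) auto
    then show ?thesis using sN by simp
  qed
  have sn: "s\<^sup>2 * real n \<le> 4 / 25 * N"
  proof -
    have "s\<^sup>2 * real n = (s\<^sup>2 * N\<^sup>2) * N" by (simp add: power2_eq_square flip: N3) (simp add: power3_eq_cube)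
    also have "\<dots> \<le> 4 / 25 * N" using sN N1 by (intro mult_right_mono) auto
    finally show ?thesis .
  qed
  have "exp (- (320 / \<delta>) * N) \<le> norm (G l z)"
  proof -
    have "norm (Q \<zeta>) = norm (G l z) * s\<^sup>2" by (simp add: Q_def z_def s_def norm_mult norm_power)
    also have "\<dots> \<le> norm (G l z) * 1" using s1 by (intro mult_left_mono) auto
    finally have "(16 / \<delta>) ^ (M - 1) * norm (Q \<zeta>) \<le> (16 / \<delta>) ^ (M - 1) * norm (G l z)"
      using \<delta> by (intro mult_left_mono) auto
    with z(3) have "1 \<le> (16 / \<delta>) ^ (M - 1) * norm (G l z)" by linarith
    also have "(16 / \<delta>) ^ (M - 1) \<le> exp (16 / \<delta>) ^ (M - 1)"
      using \<delta> less_imp_le[OF exp_gt_self[of "16 / \<delta>"]] by (intro power_mono) auto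
    also have "\<dots> = exp (real (M - 1) * (16 / \<delta>))" by (simp only: exp_of_nat_mult)
    also have "\<dots> \<le> exp (20 * N * (16 / \<delta>))"
      using \<delta> M(2) by (intro iffD2[OF exp_le_cancel_iff] mult_right_mono) auto
    finally have "1 \<le> exp (320 / \<delta> * N) * norm (G l z)" by (simp add: mult_right_mono mult.commute)
    then show ?thesis by (simp add: exp_minus field_simps)
  qed
  moreover have "exp (- N) \<le> norm (prod_list (map (\<phi> z) ps))"
  proof -
    have "exp (- (5 / 2 * s\<^sup>2)) \<le> norm (\<phi> z t)" if "t \<in> {a, c}" for t
    proof (rule power2_le_imp_le)
      have "r t * Re (1 - z) \<le> 1 * (5 / 4 * s\<^sup>2)" using r[OF that] \<delta> est by (intro mult_mono) auto
      then have "2 * r t * Re (1 - z) \<le> 5 / 2 * s\<^sup>2" by linarith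
      moreover have "0 \<le> (r t)\<^sup>2 * (norm (1 - z))\<^sup>2" by simp
      ultimately have "1 - 5 / 2 * s\<^sup>2 \<le> (norm (\<phi> z t))\<^sup>2"
        unfolding \<phi>_def norm_affine_squared by linarith
      moreover have "exp (- 2 * (5 / 2 * s\<^sup>2)) \<le> 1 - 5 / 2 * s\<^sup>2"
        by (rule exp_minus_le_affine) (use s1 in auto)
      ultimately show "(exp (- (5 / 2 * s\<^sup>2)))\<^sup>2 \<le> (norm (\<phi> z t))\<^sup>2"
        by (simp flip: exp_double)
    qed simp
    then have "exp (- (5 / 2 * s\<^sup>2) * real (length ps)) \<le> norm (prod_list (map (\<phi> z) ps))"
      using uv pre by (intro norm_prod_list_ge) auto
    moreover have "s\<^sup>2 * real (length ps) \<le> s\<^sup>2 * real n"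
      using uv pre by (intro mult_left_mono) auto
    then have "5 / 2 * (s\<^sup>2 * real (length ps)) \<le> N" using sn N1 by linarith
    then have "- N \<le> - (5 / 2 * s\<^sup>2) * real (length ps)" by simp
    ultimately show ?thesis by (meson exp_le_cancel_iff order_trans)
  qed
  moreover have "exp (- N / \<delta>) \<le> p l"
  proof -
    have "1 / \<delta> \<le> N / \<delta>" using N1 \<delta> by (intro divide_right_mono) auto
    then have "exp (- N / \<delta>) \<le> exp (- (1 / \<delta>))" by simp
    also have "1 / \<delta> \<le> exp (1 / \<delta>)" using exp_ge_add_one_self[of "1 / \<delta>"] by linarith
    then have "exp (- (1 / \<delta>)) \<le> \<delta>" using \<delta> by (simp add: exp_minus field_simps)
    also have "\<delta> \<le> p l" using p l by auto
    finally show ?thesis .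
  qed
  ultimately have "exp (- N / \<delta>) * (exp (- N) * exp (- (320 / \<delta>) * N)) \<le>
      p l * (norm (prod_list (map (\<phi> z) ps)) * norm (G l z))"
    using p[OF l(1)] \<delta> by (intro mult_mono) auto
  then have lower: "exp (- N - 321 / \<delta> * N) \<le> p l * (norm (prod_list (map (\<phi> z) ps)) * norm (G l z))"
    by (simp add: algebra_simps flip: exp_add)
  define \<Delta> where "\<Delta> k = trace_mean p u (letter_at l k) - trace_mean p v (letter_at l k)" for k
  have mean: "trace_mean p x (occurrence_sum (\<lambda>_. w) l) = (\<Sum>k<n. w ^ k * of_real (trace_mean p x (letter_at l k)))"
    if "length x \<le> n" for x
  proof -
    have "trace_mean p x (occurrence_sum (\<lambda>_. w) l) =
        trace_mean p x (\<lambda>ys. \<Sum>k<n. w ^ k * complex_of_real (letter_at l k ys))"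
      using that by (intro trace_mean_cong occurrence_sum_const) auto
    then show ?thesis by (simp add: trace_mean_sum trace_mean_mult trace_mean_of_real)
  qed
  \<comment> \<open>The point \<open>w\<close> was defined so that the mean weights become the functions \<open>\<phi> z\<close> of \<open>z\<close>.\<close>
  have \<phi>w: "1 - of_real (p t) * (1 - w) = \<phi> z t" for t
    by (simp add: w_def \<phi>_def r_def)
  have mean_z: "trace_mean p x (occurrence_sum (\<lambda>_. w) l) = of_real (p l) * occurrence_sum (\<phi> z) l x"
    if "set x \<subseteq> {a, c}" for x
  proof -
    have "0 \<le> p t \<and> p t \<le> 1" if "t \<in> {a, c}" for t using p[OF that] \<delta> by auto
    with that show ?thesis unfolding \<phi>w[symmetric]
      by (intro trace_mean_occurrence_sum) blast
  qed
  have "(\<Sum>k<n. w ^ k * of_real (\<Delta> k)) =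
      trace_mean p u (occurrence_sum (\<lambda>_. w) l) - trace_mean p v (occurrence_sum (\<lambda>_. w) l)"
    unfolding mean[OF uv(3)] mean[OF uv(4)]
    by (simp add: \<Delta>_def right_diff_distrib sum_subtractf)
  also have "\<dots> = of_real (p l) * (occurrence_sum (\<phi> z) l u - occurrence_sum (\<phi> z) l v)"
    unfolding mean_z[OF uv(1)] mean_z[OF uv(2)] by (simp add: right_diff_distrib)
  also have "\<dots> = of_real (p l) * (prod_list (map (\<phi> z) ps) * G l z)"
    unfolding pre occurrence_sum_common_prefix G_def ..
  finally have "(\<Sum>k<n. w ^ k * of_real (\<Delta> k)) = of_real (p l) * (prod_list (map (\<phi> z) ps) * G l z)" .
  then have eq: "norm (\<Sum>k<n. w ^ k * of_real (\<Delta> k)) = p l * (norm (prod_list (map (\<phi> z) ps)) * norm (G l z))"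
    using p[OF l(1)] \<delta> by (simp add: norm_mult)
  \<comment> \<open>A bound \<open>W \<ge> 1\<close> for \<open>\<bar>w\<bar>\<close> also controls the powers with \<open>k < n\<close> by \<open>W ^ n\<close>.\<close>
  define W where "W = exp (9 / 8 * (s\<^sup>2 / \<delta>\<^sup>2))"
  have "norm w \<le> W"
  proof (rule power2_le_imp_le)
    have "(1 / p c)\<^sup>2 \<le> (1 / \<delta>)\<^sup>2" using pc \<delta> by (intro power_mono frac_le) auto
    then have "(1 / p c)\<^sup>2 * (norm (1 - z))\<^sup>2 \<le> (1 / \<delta>)\<^sup>2 * (9 / 4 * s\<^sup>2)"
      using est by (intro mult_mono) auto
    moreover have "0 \<le> 2 * (1 / p c) * Re (1 - z)" using est pc by auto
    moreover have "w = 1 - of_real (1 / p c) * (1 - z)" by (simp add: w_def)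
    ultimately have "(norm w)\<^sup>2 \<le> 1 + 9 / 4 * (s\<^sup>2 / \<delta>\<^sup>2)"
      using norm_affine_squared[of "1 / p c" z] by (simp add: power_divide)
    also have "\<dots> \<le> exp (9 / 4 * (s\<^sup>2 / \<delta>\<^sup>2))" by simp
    also have "\<dots> = W\<^sup>2" by (simp add: W_def flip: exp_double)
    finally show "(norm w)\<^sup>2 \<le> W\<^sup>2" .
  qed (simp add: W_def)
  have W1: "1 \<le> W" by (simp add: W_def)
  have Wn: "W ^ n \<le> exp (N / \<delta>\<^sup>2)"
  proof -
    have "W ^ n = exp (9 / 8 * (s\<^sup>2 * real n) / \<delta>\<^sup>2)" by (simp add: W_def flip: exp_of_nat_mult)
    moreover have "9 / 8 * (s\<^sup>2 * real n) / \<delta>\<^sup>2 \<le> N / \<delta>\<^sup>2"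
      using sn N1 by (intro divide_right_mono) auto
    ultimately show ?thesis by simp
  qed
  have "\<exists>k<n. exp (- separation_rate \<delta> * N) \<le> \<bar>\<Delta> k\<bar>"
  proof (rule ccontr)
    assume "\<not> ?thesis"
    then have small: "\<bar>\<Delta> k\<bar> \<le> exp (- separation_rate \<delta> * N)" if "k < n" for k using that by force
    have "norm (w ^ k * of_real (\<Delta> k)) \<le> exp (N / \<delta>\<^sup>2) * exp (- separation_rate \<delta> * N)" if "k < n" for k
    proof -
      have "norm (w ^ k) \<le> W ^ k" unfolding norm_power using \<open>norm w \<le> W\<close> by (intro power_mono) auto
      also have "\<dots> \<le> W ^ n" using W1 that by (intro power_increasing) auto
      finally show ?thesis
        unfolding norm_mult using Wn small[OF that] by (intro mult_mono) auto
    qed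
    then have "norm (\<Sum>k<n. w ^ k * of_real (\<Delta> k)) \<le> real n * (exp (N / \<delta>\<^sup>2) * exp (- separation_rate \<delta> * N))"
      using sum_norm_bound[of "{..<n}" "\<lambda>k. w ^ k * of_real (\<Delta> k)"] by simp
    also have "\<dots> \<le> exp (3 * N) * (exp (N / \<delta>\<^sup>2) * exp (- separation_rate \<delta> * N))"
      using le_exp_cube_root[of n] by (intro mult_right_mono) (auto simp: N_def)
    also have "\<dots> = exp (- 2 * N - 321 / \<delta> * N)"
      by (simp add: separation_rate_def algebra_simps flip: exp_add)
    also have "\<dots> < exp (- N - 321 / \<delta> * N)" using N1 by simp
    finally show False using lower eq by simp
  qed
  then show ?thesis using l(1) unfolding \<Delta>_def N_def by blast
qed

text \<open>
  Restricting to the first letters of the two strings shows that these agree.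
\<close>

lemma filter_pairs_determine:
  assumes "\<And>a c. a \<in> set x \<union> set y \<Longrightarrow> c \<in> set x \<union> set y \<Longrightarrow>
    filter (\<lambda>t. t \<in> {a, c}) x = filter (\<lambda>t. t \<in> {a, c}) y"
  shows "x = y"
  using assms
proof (induction x arbitrary: y)
  case Nil
  then show ?case by (cases y) force+
next
  case (Cons s x)
  from Cons.prems[of s s] obtain t y' where y: "y = t # y'" by (cases y) auto
  have "s = t" using Cons.prems[of s t] y by (auto split: if_splits)
  moreover have "x = y'"
  proof (rule Cons.IH)
    fix a c assume "a \<in> set x \<union> set y'" "c \<in> set x \<union> set y'"
    then show "filter (\<lambda>t. t \<in> {a, c}) x = filter (\<lambda>t. t \<in> {a, c}) y'"
      using Cons.prems[of a c] y \<open>s = t\<close> by (auto split: if_splits)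
  qed
  ultimately show ?case using y by simp
qed

section \<open>A finite family of statistics that identifies the input\<close>

text \<open>
  The first two kinds determine the retention probabilities of the letters that occur, the third one determines the string. Counts
  are divided by \<open>n\<close> so that all values on traces lie in \<open>[0, 1]\<close>.
\<close>

definition test_statistics :: "nat \<Rightarrow> nat \<Rightarrow> (nat list \<Rightarrow> real) set" where
  "test_statistics m n =
     (\<lambda>a ys. count_list ys a / n) ` {..<m} \<union> (\<lambda>a ys. (count_list ys a / n)\<^sup>2) ` {..<m} \<union>
     (\<lambda>(a, c, l, k) ys. letter_at l k (filter (\<lambda>t. t \<in> {a, c}) ys))
       ` ({..<m} \<times> {..<m} \<times> {..<m} \<times> {..<n})"

lemma finite_test_statistics: "finite (test_statistics m n)"
  by (simp add: test_statistics_def)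

lemma card_test_statistics:
  assumes "m \<ge> 1" "n \<ge> 1"
  shows "card (test_statistics m n) \<le> 3 * m ^ 3 * n"
proof -
  have "card (test_statistics m n) \<le> m + m + m * (m * (m * n))"
    unfolding test_statistics_def
    by (intro order_trans[OF card_Un_le] add_mono order_trans[OF card_image_le]) auto
  moreover have "m * 1 \<le> m * (m * (m * n))"
    using assms by (intro mult_le_mono) auto
  ultimately have "card (test_statistics m n) \<le> 3 * (m * (m * (m * n)))" by linarith
  then show ?thesis by (simp add: power3_eq_cube mult.assoc)
qed

lemma test_statistics_bounds:
  assumes "f \<in> test_statistics m n" "ys \<in> traces m n"
  shows "0 \<le> f ys \<and> f ys \<le> 1"
proof -
  have "count_list ys a / n \<le> 1" for a
    using count_le_length[of ys a] assms(2) by (auto simp: traces_def strings_def divide_le_eq)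
  moreover from this have "(count_list ys a / n)\<^sup>2 \<le> 1" for a by (intro power_le_one) auto
  ultimately show ?thesis using assms(1)
    by (auto simp: test_statistics_def letter_at_def)
qed

text \<open>
  For a binomial variable with mean \<open>\<mu>\<close> and success probability \<open>p\<close> the second moment is
  \<open>\<mu> (1 - p + \<mu>)\<close>. So \<open>\<mu> p\<close> is a polynomial in the first two moments, and \<open>p\<close> can be recovered stably
  because one of the means is at least \<open>\<delta>\<close>.
\<close>

lemma retention_prob_from_moments:
  fixes n \<theta> :: real
  assumes "0 < \<delta>" "\<delta> \<le> \<mu>'" "0 \<le> \<mu>" "\<mu> \<le> n" "\<mu>' \<le> n" "0 \<le> p" "p \<le> 1" "1 \<le> n"
    and 1: "\<bar>\<mu> - \<mu>'\<bar> \<le> n * \<theta>"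
    and 2: "\<bar>\<mu> * (1 - p + \<mu>) - \<mu>' * (1 - p' + \<mu>')\<bar> \<le> n\<^sup>2 * \<theta>"
  shows "\<bar>p - p'\<bar> \<le> 5 * n\<^sup>2 * \<theta> / \<delta>"
proof -
  have nt: "0 \<le> n * \<theta>" using 1 by linarith
  have n2: "n * \<theta> \<le> n\<^sup>2 * \<theta>"
    using mult_right_mono[OF \<open>1 \<le> n\<close> nt] by (simp add: power2_eq_square mult.assoc)
  have "\<bar>(\<mu> - \<mu>') * (\<mu> + \<mu>')\<bar> \<le> (n * \<theta>) * (2 * n)"
    unfolding abs_mult using assms by (intro mult_mono) auto
  then have 3: "\<bar>\<mu>\<^sup>2 - \<mu>'\<^sup>2\<bar> \<le> 2 * (n\<^sup>2 * \<theta>)"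
    by (simp add: power2_eq_square algebra_simps)
  have 4: "\<bar>p * (\<mu> - \<mu>')\<bar> \<le> 1 * (n * \<theta>)"
    unfolding abs_mult using assms by (intro mult_mono) auto
  have "\<mu>' * (p - p') = (\<mu> - \<mu>') + (\<mu>\<^sup>2 - \<mu>'\<^sup>2)
      - (\<mu> * (1 - p + \<mu>) - \<mu>' * (1 - p' + \<mu>')) - p * (\<mu> - \<mu>')"
    by (simp add: power2_eq_square algebra_simps)
  then have "\<bar>\<mu>' * (p - p')\<bar> \<le> 5 * (n\<^sup>2 * \<theta>)"
    using 1 2 3 4 n2 by linarith
  moreover have "\<delta> * \<bar>p - p'\<bar> \<le> \<bar>\<mu>' * (p - p')\<bar>"
    unfolding abs_mult using assms by (intro mult_right_mono) auto
  ultimately show ?thesis using \<open>0 < \<delta>\<close> by (simp add: field_simps)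
qed

text \<open>
  On top of \<open>separation_rate\<close>: \<open>9\<close> for the factor \<open>n\<^sup>3\<close> lost in comparing the retention
  probabilities, \<open>12 / \<delta>\<close> for the constant of that comparison, and \<open>1\<close> for strictness.
\<close>

definition identification_rate :: "real \<Rightarrow> real" where
  "identification_rate \<delta> = separation_rate \<delta> + 10 + 12 / \<delta>"

text \<open>
  Close counts force close probabilities on the letters of \<open>y\<close>. Then \<open>p'\<close> may be
  replaced by \<open>p\<close> at a small cost, and \<open>two_letter_separation\<close> applies to a pair of letters on which
  \<open>x\<close> and \<open>y\<close> differ.
\<close>

lemma test_statistics_identify:
  assumes \<delta>: "0 < \<delta>" "\<delta> \<le> 1" and n: "n \<ge> 1"
    and xy: "x \<in> strings m n" "y \<in> strings m n"
    and p: "\<And>t. t < m \<Longrightarrow> \<delta> \<le> p t \<and> p t \<le> 1" and p': "\<And>t. t < m \<Longrightarrow> \<delta> \<le> p' t \<and> p' t \<le> 1"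
    and close: "\<And>f. f \<in> test_statistics m n \<Longrightarrow> \<bar>trace_mean p x f - trace_mean p' y f\<bar> \<le>
      2 * exp (- identification_rate \<delta> * real n powr (1/3))"
  shows "x = y"
proof (rule ccontr)
  assume "x \<noteq> y"
  define N where "N = real n powr (1/3)"
  have N1: "N \<ge> 1" using n by (simp add: N_def ge_one_powr_ge_zero)
  define \<theta> where "\<theta> = 2 * exp (- identification_rate \<delta> * N)"
  have \<theta>: "0 < \<theta>" by (simp add: \<theta>_def)
  have setxy: "set x \<subseteq> {..<m}" "set y \<subseteq> {..<m}" "length x = n" "length y = n"
    using xy by (auto simp: strings_def)
  have px: "0 \<le> p t \<and> p t \<le> 1" "0 \<le> p' t \<and> p' t \<le> 1" if "t < m" for t
    using p[OF that] p'[OF that] \<delta> by auto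
  have pp: "\<bar>p t - p' t\<bar> \<le> 5 * (real n)\<^sup>2 * \<theta> / \<delta>" if t: "t \<in> set y" for t
  proof -
    have tm: "t < m" using t setxy by auto
    define \<mu> \<mu>' where "\<mu> = real (count_list x t) * p t" and "\<mu>' = real (count_list y t) * p' t"
    have cnt: "trace_mean q w (\<lambda>ys. real (count_list ys t) / n) = trace_mean q w (\<lambda>ys. real (count_list ys t)) / n"
      "trace_mean q w (\<lambda>ys. (real (count_list ys t) / n)\<^sup>2) = trace_mean q w (\<lambda>ys. (real (count_list ys t))\<^sup>2) / n\<^sup>2"
      for q w
      using trace_mean_mult[of q w "1 / real n"] trace_mean_mult[of q w "1 / (real n)\<^sup>2"]
      by (simp_all add: power_divide)
    have mx: "trace_mean p x (\<lambda>ys. real (count_list ys t)) = \<mu>"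
      "trace_mean p x (\<lambda>ys. (real (count_list ys t))\<^sup>2) = \<mu> * (1 - p t + \<mu>)"
      unfolding \<mu>_def using setxy px tm by (intro trace_mean_count; blast)+
    have my: "trace_mean p' y (\<lambda>ys. real (count_list ys t)) = \<mu>'"
      "trace_mean p' y (\<lambda>ys. (real (count_list ys t))\<^sup>2) = \<mu>' * (1 - p' t + \<mu>')"
      unfolding \<mu>'_def using setxy px tm by (intro trace_mean_count; blast)+
    have "(\<lambda>ys. real (count_list ys t) / n) \<in> test_statistics m n"
      "(\<lambda>ys. (real (count_list ys t) / n)\<^sup>2) \<in> test_statistics m n"
      using tm by (auto simp: test_statistics_def)
    from close[OF this(1)] close[OF this(2)]
    have "\<bar>\<mu> / n - \<mu>' / n\<bar> \<le> \<theta>"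
      "\<bar>\<mu> * (1 - p t + \<mu>) / n\<^sup>2 - \<mu>' * (1 - p' t + \<mu>') / n\<^sup>2\<bar> \<le> \<theta>"
      by (simp_all only: cnt mx my \<theta>_def N_def)
    then have close': "\<bar>\<mu> - \<mu>'\<bar> \<le> real n * \<theta>"
      "\<bar>\<mu> * (1 - p t + \<mu>) - \<mu>' * (1 - p' t + \<mu>')\<bar> \<le> (real n)\<^sup>2 * \<theta>"
      using n by (simp_all add: abs_divide field_simps flip: diff_divide_distrib)
    have "real (count_list x t) * p t \<le> real n * 1" "real (count_list y t) * p' t \<le> real n * 1"
      using px[OF tm] count_le_length[of x t] count_le_length[of y t] setxy by (intro mult_mono; simp)+
    moreover have "1 * \<delta> \<le> real (count_list y t) * p' t"
    proof (rule mult_mono)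
      have "count_list y t \<noteq> 0" using t by (simp add: count_list_0_iff)
      then show "1 \<le> real (count_list y t)" by simp
    qed (use p'[OF tm] \<delta> in auto)
    ultimately show ?thesis
      using close' px[OF tm] n \<delta>
      by (intro retention_prob_from_moments[of \<delta> \<mu>' \<mu>]) (auto simp: \<mu>_def \<mu>'_def)
  qed
  obtain a c where ac: "a < m" "c < m" "filter (\<lambda>t. t \<in> {a, c}) x \<noteq> filter (\<lambda>t. t \<in> {a, c}) y" "p a \<le> p c"
  proof -
    obtain a c where "a < m" "c < m" "filter (\<lambda>t. t \<in> {a, c}) x \<noteq> filter (\<lambda>t. t \<in> {a, c}) y"
      using filter_pairs_determine[of x y] \<open>x \<noteq> y\<close> setxy by blast
    then show ?thesis using that[of a c] that[of c a]
      by (cases "p a \<le> p c") (auto simp: disj_commute)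
  qed
  define pr where "pr = filter (\<lambda>t. t \<in> {a, c})"
  have "\<exists>l\<in>{a, c}. \<exists>k<n. exp (- separation_rate \<delta> * real n powr (1/3)) \<le>
    \<bar>trace_mean p (pr x) (letter_at l k) - trace_mean p (pr y) (letter_at l k)\<bar>"
  proof (rule two_letter_separation[OF \<delta> _ ac(4)])
    show "length (pr x) \<le> n" "length (pr y) \<le> n"
      using setxy length_filter_le unfolding pr_def by metis+
    show "pr x \<noteq> pr y" using ac(3) by (simp add: pr_def)
  qed (use p ac in \<open>auto simp: pr_def\<close>)
  then obtain l k where lk: "l \<in> {a, c}" "k < n"
    "exp (- separation_rate \<delta> * N) \<le> \<bar>trace_mean p (pr x) (letter_at l k) - trace_mean p (pr y) (letter_at l k)\<bar>"
    unfolding N_def by blast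
  define f where "f ys = letter_at l k (pr ys)" for ys
  have fE: "trace_mean q w f = trace_mean q (pr w) (letter_at l k)" for q w
    unfolding f_def pr_def by (rule trace_mean_filter)
  have "l < m" using lk ac by auto
  then have "(\<lambda>(a, c, l, k) ys. letter_at l k (filter (\<lambda>t. t \<in> {a, c}) ys)) (a, c, l, k) \<in> test_statistics m n"
    unfolding test_statistics_def using ac lk by blast
  moreover have "(\<lambda>(a, c, l, k) ys. letter_at l k (filter (\<lambda>t. t \<in> {a, c}) ys)) (a, c, l, k) = f"
    by (simp add: f_def pr_def fun_eq_iff)
  ultimately have "f \<in> test_statistics m n" by simp
  from close[OF this] have A: "\<bar>trace_mean p x f - trace_mean p' y f\<bar> \<le> \<theta>"
    by (simp add: \<theta>_def N_def)
  have B: "\<bar>trace_mean p y f - trace_mean p' y f\<bar> \<le> real (length y) * (5 * (real n)\<^sup>2 * \<theta> / \<delta>)"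
  proof (rule trace_mean_Lipschitz)
    show "0 \<le> f ys \<and> f ys \<le> 1" for ys by (simp add: f_def letter_at_def)
  qed (use px pp setxy in auto)
  have "real (length y) * (5 * (real n)\<^sup>2 * \<theta> / \<delta>) = 5 * (real n ^ 3 * \<theta> / \<delta>)"
    by (simp add: setxy power2_eq_square power3_eq_cube)
  moreover have "\<theta> \<le> real n ^ 3 * \<theta> / \<delta>"
  proof -
    have "1 * \<theta> * 1 \<le> real n ^ 3 * \<theta> * (1 / \<delta>)"
      using n \<theta> \<delta> by (intro mult_mono) auto
    then show ?thesis by simp
  qed
  ultimately have "exp (- separation_rate \<delta> * N) \<le> 6 * (real n ^ 3 * \<theta> / \<delta>)"
    using A B lk(3) unfolding fE[of p x] fE[of p y] by linarith
  also have "\<dots> = (12 / \<delta>) * real n ^ 3 * exp (- identification_rate \<delta> * N)"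
    by (simp add: \<theta>_def)
  also have "\<dots> \<le> exp (12 / \<delta> * N) * exp (3 * N) ^ 3 * exp (- identification_rate \<delta> * N)"
  proof (intro mult_right_mono mult_mono power_mono)
    have "12 / \<delta> * 1 \<le> 12 / \<delta> * N" using \<delta> N1 by (intro mult_left_mono) auto
    also have "\<dots> \<le> exp (12 / \<delta> * N)" by (rule less_imp_le[OF exp_gt_self])
    finally show "12 / \<delta> \<le> exp (12 / \<delta> * N)" by simp
  qed (use le_exp_cube_root[of n] \<delta> in \<open>auto simp: N_def\<close>)
  also have "\<dots> = exp (- separation_rate \<delta> * N - N)"
    by (simp add: identification_rate_def algebra_simps flip: exp_of_nat_mult exp_add)
  finally show False using N1 by simp
qed

section \<open>Concentration of empirical means and decoding\<close>

lemma replicate_pmf_Suc_map: "replicate_pmf (Suc T) M = bind_pmf M (\<lambda>y. map_pmf ((#) y) (replicate_pmf T M))"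
  by (simp add: map_pmf_def)

lemma finite_set_replicate_pmf: "finite (set_pmf M) \<Longrightarrow> finite (set_pmf (replicate_pmf T M))"
  by (induction T) auto

lemma expectation_replicate_pmf_Suc:
  fixes h :: "'a list \<Rightarrow> real"
  assumes "finite (set_pmf M)"
  shows "measure_pmf.expectation (replicate_pmf (Suc T) M) h =
    measure_pmf.expectation M (\<lambda>y. measure_pmf.expectation (replicate_pmf T M) (\<lambda>ys. h (y # ys)))"
  unfolding replicate_pmf_Suc_map
  by (subst pmf_expectation_bind[OF assms], simp add: assms finite_set_replicate_pmf, simp,
      subst integral_measure_pmf[OF assms], assumption, simp)

text \<open>
  The variance of a sum of independent terms is additive.
\<close>

lemma replicate_pmf_moments:
  fixes g :: "'a \<Rightarrow> real"
  assumes fin: "finite (set_pmf M)" and "measure_pmf.expectation M g = 0"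
    and "\<And>y. y \<in> set_pmf M \<Longrightarrow> \<bar>g y\<bar> \<le> 1"
  shows "measure_pmf.expectation (replicate_pmf T M) (\<lambda>Y. sum_list (map g Y)) = 0"
    and "measure_pmf.expectation (replicate_pmf T M) (\<lambda>Y. (sum_list (map g Y))\<^sup>2) \<le> real T"
proof -
  note int = integrable_measure_pmf_finite[OF fin]
    integrable_measure_pmf_finite[OF finite_set_replicate_pmf[OF fin]]
  have mean: "measure_pmf.expectation (replicate_pmf T M) (\<lambda>Y. sum_list (map g Y)) = 0" for T
  proof (induction T)
    case (Suc T)
    then show ?case
      unfolding expectation_replicate_pmf_Suc[OF fin] by (simp add: int assms(2))
  qed simp
  then show "measure_pmf.expectation (replicate_pmf T M) (\<lambda>Y. sum_list (map g Y)) = 0" .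
  have "measure_pmf.expectation M (\<lambda>y. (g y)\<^sup>2) \<le> measure_pmf.expectation M (\<lambda>_. 1)"
    using assms(3) by (intro integral_mono_AE int) (auto simp: AE_measure_pmf_iff abs_square_le_1)
  then have var: "measure_pmf.expectation M (\<lambda>y. (g y)\<^sup>2) \<le> 1" by simp
  show "measure_pmf.expectation (replicate_pmf T M) (\<lambda>Y. (sum_list (map g Y))\<^sup>2) \<le> real T"
  proof (induction T)
    case (Suc T)
    have "measure_pmf.expectation (replicate_pmf T M) (\<lambda>Y. (sum_list (map g (y # Y)))\<^sup>2) =
      (g y)\<^sup>2 + measure_pmf.expectation (replicate_pmf T M) (\<lambda>Y. (sum_list (map g Y))\<^sup>2)" for y
      by (simp add: power2_sum int mean)
    then show ?case
      unfolding expectation_replicate_pmf_Suc[OF fin] using Suc var by (simp add: int)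
  qed simp
qed

lemma empirical_mean_deviation:
  fixes f :: "'a \<Rightarrow> real"
  assumes fin: "finite (set_pmf M)" and f: "\<And>y. y \<in> set_pmf M \<Longrightarrow> 0 \<le> f y \<and> f y \<le> 1"
    and "T > 0" "\<eta> > 0"
  shows "measure_pmf.prob (replicate_pmf T M)
    {Y. \<eta> * real T \<le> \<bar>sum_list (map f Y) - T * measure_pmf.expectation M f\<bar>} \<le> 1 / (T * \<eta>\<^sup>2)"
proof -
  define \<mu> where "\<mu> = measure_pmf.expectation M f"
  define g where "g y = f y - \<mu>" for y
  note int = integrable_measure_pmf_finite[OF fin]
  have "0 \<le> \<mu>" unfolding \<mu>_def
    by (rule integral_nonneg_AE) (use f in \<open>auto simp: AE_measure_pmf_iff\<close>)
  moreover have "\<mu> \<le> measure_pmf.expectation M (\<lambda>_. 1)" unfolding \<mu>_def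
    by (intro integral_mono_AE int) (use f in \<open>auto simp: AE_measure_pmf_iff\<close>)
  ultimately have \<mu>: "0 \<le> \<mu>" "\<mu> \<le> 1" by simp_all
  have g: "\<bar>g y\<bar> \<le> 1" if "y \<in> set_pmf M" for y
    using f[OF that] \<mu> unfolding g_def by linarith
  have g0: "measure_pmf.expectation M g = 0" by (simp add: g_def[abs_def] int \<mu>_def[symmetric])
  have sumg: "sum_list (map g Y) = sum_list (map f Y) - real (length Y) * \<mu>" for Y
    by (induction Y) (simp_all add: g_def algebra_simps)
  let ?R = "measure_pmf (replicate_pmf T M)"
  have "measure ?R {Y. \<eta> * real T \<le> \<bar>sum_list (map f Y) - real T * \<mu>\<bar>} =
      measure ?R {Y. (\<eta> * real T)\<^sup>2 \<le> (sum_list (map g Y))\<^sup>2}"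
  proof (rule measure_pmf.finite_measure_eq_AE)
    show "AE Y in ?R. (Y \<in> {Y. \<eta> * real T \<le> \<bar>sum_list (map f Y) - real T * \<mu>\<bar>}) =
        (Y \<in> {Y. (\<eta> * real T)\<^sup>2 \<le> (sum_list (map g Y))\<^sup>2})"
      using assms(3,4)
      by (auto simp: AE_measure_pmf_iff set_replicate_pmf sumg abs_le_square_iff[symmetric])
  qed auto
  also have "\<dots> \<le> integral\<^sup>L ?R (\<lambda>Y. (sum_list (map g Y))\<^sup>2) / (\<eta> * real T)\<^sup>2"
    using integral_Markov_inequality_measure[of ?R "\<lambda>Y. (sum_list (map g Y))\<^sup>2" "{}" "(\<eta> * real T)\<^sup>2"] assms(3,4)
    by (simp add: integrable_measure_pmf_finite[OF finite_set_replicate_pmf[OF fin]])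
  also have "\<dots> \<le> real T / (\<eta> * real T)\<^sup>2"
    using replicate_pmf_moments(2)[OF fin g0 g] by (intro divide_right_mono) auto
  also have "\<dots> = 1 / (T * \<eta>\<^sup>2)" using assms(3) by (simp add: power2_eq_square)
  finally show ?thesis unfolding \<mu>_def .
qed

text \<open>
  The decoder picks any string that, with some admissible \<open>p\<close>, predicts all empirical means up to
  \<open>\<eta>\<close>. Two such strings have statistics within \<open>2 * \<eta>\<close> of each other, hence coincide; so the decoder
  errs only if the true string fails some test.
\<close>

lemma reconstruction_from_separating_tests:
  fixes \<Phi> :: "(nat list \<Rightarrow> real) set"
  assumes fin: "finite \<Phi>" and "m \<ge> 1" "T > 0" "\<eta> > 0" and card: "real (card \<Phi>) \<le> \<epsilon> * (T * \<eta>\<^sup>2)"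
    and bounded: "\<And>f ys. f \<in> \<Phi> \<Longrightarrow> ys \<in> traces m n \<Longrightarrow> 0 \<le> f ys \<and> f ys \<le> 1"
    and separating: "\<And>x y p p'. x \<in> strings m n \<Longrightarrow> y \<in> strings m n \<Longrightarrow> p \<in> P \<Longrightarrow> p' \<in> P \<Longrightarrow>
      (\<And>f. f \<in> \<Phi> \<Longrightarrow> \<bar>trace_mean p x f - trace_mean p' y f\<bar> \<le> 2 * \<eta>) \<Longrightarrow> x = y"
  shows "\<exists>F. \<forall>p\<in>P. reconstructs m n T \<epsilon> p F"
proof -
  define good where "good x Y \<longleftrightarrow> x \<in> strings m n \<and>
      (\<exists>p\<in>P. \<forall>f\<in>\<Phi>. \<bar>sum_list (map f Y) - T * trace_mean p x f\<bar> < \<eta> * T)" for x Y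
  define F where "F Y = (if \<exists>x. good x Y then SOME x. good x Y else replicate n 0)" for Y
  have unique: "x = y" if gx: "good x Y" and gy: "good y Y" for x y Y
  proof -
    obtain p p' where pp: "p \<in> P" "p' \<in> P"
      "\<And>f. f \<in> \<Phi> \<Longrightarrow> \<bar>sum_list (map f Y) - T * trace_mean p x f\<bar> < \<eta> * T"
      "\<And>f. f \<in> \<Phi> \<Longrightarrow> \<bar>sum_list (map f Y) - T * trace_mean p' y f\<bar> < \<eta> * T"
      using gx gy unfolding good_def by blast
    have "\<bar>trace_mean p x f - trace_mean p' y f\<bar> \<le> 2 * \<eta>" if "f \<in> \<Phi>" for f
    proof -
      have "\<bar>T * trace_mean p x f - T * trace_mean p' y f\<bar> \<le> 2 * \<eta> * T"
        using pp(3,4)[OF that] by linarith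
      then have "T * \<bar>trace_mean p x f - trace_mean p' y f\<bar> \<le> T * (2 * \<eta>)"
        by (simp add: abs_mult mult.commute flip: right_diff_distrib)
      then show ?thesis using assms(3) by simp
    qed
    then show ?thesis using separating[of x y p p'] gx gy pp(1,2) by (simp add: good_def)
  qed
  have F_eq: "F Y = x" if "good x Y" for x Y
    using that unique unfolding F_def by (metis someI)
  have "reconstructs m n T \<epsilon> p F" if p: "p \<in> P" for p
    unfolding reconstructs_def
  proof (intro conjI ballI)
    have "F Y \<in> strings m n" for Y
    proof (cases "\<exists>x. good x Y")
      case True
      then show ?thesis using F_eq good_def by auto
    next
      case False
      then show ?thesis using assms(2) by (auto simp: F_def strings_def)
    qed
    then show "F \<in> {Y. length Y = T \<and> set Y \<subseteq> traces m n} \<rightarrow> strings m n" by blast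
    fix x assume x: "x \<in> strings m n"
    let ?R = "replicate_pmf T (deletion_channel p x)"
    define bad where "bad f = {Y. \<eta> * T \<le> \<bar>sum_list (map f Y) - T * trace_mean p x f\<bar>}" for f :: "nat list \<Rightarrow> real"
    have "- {Y. F Y = x} \<subseteq> (\<Union>f\<in>\<Phi>. bad f)"
    proof
      fix Y assume "Y \<in> - {Y. F Y = x}"
      then have "\<not> good x Y" using F_eq by auto
      then show "Y \<in> (\<Union>f\<in>\<Phi>. bad f)" using x p by (auto simp: good_def bad_def not_less)
    qed
    then have "measure_pmf.prob ?R (- {Y. F Y = x}) \<le> measure_pmf.prob ?R (\<Union>f\<in>\<Phi>. bad f)"
      by (intro measure_pmf.finite_measure_mono) auto
    also have "\<dots> \<le> (\<Sum>f\<in>\<Phi>. measure_pmf.prob ?R (bad f))"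
      by (intro measure_pmf.finite_measure_subadditive_finite fin) auto
    also have "\<dots> \<le> (\<Sum>f\<in>\<Phi>. 1 / (T * \<eta>\<^sup>2))"
    proof (rule sum_mono)
      fix f assume "f \<in> \<Phi>"
      then show "measure_pmf.prob ?R (bad f) \<le> 1 / (T * \<eta>\<^sup>2)"
        unfolding bad_def trace_mean_def
        using bounded set_deletion_channel_traces[OF x] assms(3,4)
        by (intro empirical_mean_deviation) auto
    qed
    also have "\<dots> \<le> \<epsilon>"
      using card assms(3,4) by (simp add: divide_le_eq)
    finally have "measure_pmf.prob ?R (- {Y. F Y = x}) \<le> \<epsilon>" .
    then show "1 - \<epsilon> \<le> measure_pmf.prob ?R {Y. F Y = x}"
      using measure_pmf.prob_compl[of "{Y. F Y = x}" ?R] by (simp add: Compl_eq_Diff_UNIV)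
  qed
  then show ?thesis by blast
qed

theorem theorem1p2:
  fixes \<delta> \<epsilon> :: real and m :: nat
  assumes "\<delta> > 0" and "\<epsilon> > 0" and "m \<ge> 2"
  shows "\<exists>C::real. C > 0 \<and> (\<forall>n::nat. n \<ge> 1 \<longrightarrow>
    (let T = nat \<lceil>exp (C * real n powr (1/3))\<rceil> in
      (\<forall>p. retention_probs m p \<and> Min (p ` {..<m}) \<ge> \<delta> \<longrightarrow> (\<exists>F. reconstructs m n T \<epsilon> p F)) \<and>
      (\<exists>F. \<forall>p. retention_probs m p \<and> Min (p ` {..<m}) \<ge> \<delta> \<longrightarrow> reconstructs m n T \<epsilon> p F)))"
proof -
  \<comment> \<open>For \<open>\<delta> > 1\<close> there are no admissible probabilities, so \<open>\<delta>\<close> may be decreased to \<open>1\<close>.\<close>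
  define \<delta>' where "\<delta>' = min \<delta> 1"
  have \<delta>': "0 < \<delta>'" "\<delta>' \<le> 1" using assms(1) by (auto simp: \<delta>'_def)
  define P where "P = {p. retention_probs m p \<and> Min (p ` {..<m}) \<ge> \<delta>}"
  have P: "\<delta>' \<le> p t \<and> p t \<le> 1" if "p \<in> P" "t < m" for p t
  proof -
    have "Min (p ` {..<m}) \<le> p t" using that(2) by (intro Min_le) auto
    moreover have "\<delta> \<le> Min (p ` {..<m})" "p t \<le> 1" using that by (auto simp: P_def retention_probs_def)
    ultimately show ?thesis by (simp add: \<delta>'_def)
  qed
  define c where "c = identification_rate \<delta>'"
  \<comment> \<open>With \<open>T \<ge> exp ((2 * c + 3 + K) * N)\<close>, the terms \<open>2 * c\<close>, \<open>3\<close> and \<open>K\<close> pay for the accuracy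
    \<open>\<eta>\<^sup>2 = exp (- 2 * c * N)\<close>, for the factor \<open>n\<close> in the number of tests, and for the constant
    \<open>3 * m ^ 3 / \<epsilon>\<close>.\<close>
  define K where "K = 3 * real m ^ 3 / \<epsilon>"
  have K: "0 < K" using assms by (simp add: K_def)
  have c: "0 < c" using \<delta>' by (simp add: c_def identification_rate_def separation_rate_def add_pos_nonneg)
  have "\<exists>F. \<forall>p\<in>P. reconstructs m n (nat \<lceil>exp ((2 * c + 3 + K) * real n powr (1/3))\<rceil>) \<epsilon> p F"
    if n: "n \<ge> 1" for n
  proof (rule reconstruction_from_separating_tests)
    define N where "N = real n powr (1/3)"
    have N1: "N \<ge> 1" using n by (simp add: N_def ge_one_powr_ge_zero)
    define T where "T = nat \<lceil>exp ((2 * c + 3 + K) * N)\<rceil>"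
    have T: "exp ((2 * c + 3 + K) * N) \<le> real T" unfolding T_def by linarith
    show "0 < nat \<lceil>exp ((2 * c + 3 + K) * real n powr (1/3))\<rceil>" by simp
    show "0 < exp (- c * real n powr (1/3))" by simp
    have "real (card (test_statistics m n)) \<le> real (3 * m ^ 3 * n)"
      using card_test_statistics[of m n] assms n of_nat_le_iff by (metis One_nat_def Suc_1 Suc_leD)
    also have "\<dots> = \<epsilon> * (K * real n)" using assms by (simp add: K_def)
    also have "\<dots> \<le> \<epsilon> * (exp (K * N) * exp (3 * N))"
    proof (intro mult_left_mono mult_mono)
      have "K * 1 \<le> K * N" using K N1 by (intro mult_left_mono) auto
      also have "\<dots> \<le> exp (K * N)" by (rule less_imp_le[OF exp_gt_self])
      finally show "K \<le> exp (K * N)" by simp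
    qed (use le_exp_cube_root[of n] assms in \<open>auto simp: N_def\<close>)
    also have "\<dots> = \<epsilon> * (exp ((2 * c + 3 + K) * N) * (exp (- c * N))\<^sup>2)"
      by (simp add: algebra_simps flip: exp_add exp_double)
    also have "\<dots> \<le> \<epsilon> * (T * (exp (- c * N))\<^sup>2)"
      using T assms by (intro mult_left_mono mult_right_mono) auto
    finally show "real (card (test_statistics m n)) \<le>
      \<epsilon> * (real (nat \<lceil>exp ((2 * c + 3 + K) * real n powr (1/3))\<rceil>) * (exp (- c * real n powr (1/3)))\<^sup>2)"
      by (simp add: T_def N_def)
  next
    fix x y p p'
    assume "x \<in> strings m n" "y \<in> strings m n" "p \<in> P" "p' \<in> P"
      and "\<And>f. f \<in> test_statistics m n \<Longrightarrow>
        \<bar>trace_mean p x f - trace_mean p' y f\<bar> \<le> 2 * exp (- c * real n powr (1/3))"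
    then show "x = y"
      unfolding c_def using P n by (intro test_statistics_identify[OF \<delta>', of n x m y p p'])
  qed (use assms in \<open>auto simp: finite_test_statistics dest: test_statistics_bounds\<close>)
  then have "\<exists>F. \<forall>p. retention_probs m p \<and> Min (p ` {..<m}) \<ge> \<delta> \<longrightarrow>
      reconstructs m n (nat \<lceil>exp ((2 * c + 3 + K) * real n powr (1/3))\<rceil>) \<epsilon> p F" if "n \<ge> 1" for n
    using that unfolding P_def by simp
  moreover have "0 < 2 * c + 3 + K" using c K by simp
  ultimately show ?thesis
    unfolding Let_def by blast
qed

end
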